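(* For all integers $n\ge 1$ and all non-negative integers $k_1,\ldots,k_{n-1}$, if $k_n$ is a sufficiently large integer (how large depending on $n,k_1,\ldots,k_{n-1}$), then the $(k_1,\ldots,k_n)$-caterpillar has unimodal independent set sequence.
   Context: A $(k_1,\ldots,k_n)$-caterpillar is a path on $n$ vertices with $k_i$ pendant edges attached at the $i$th vertex of the path for each $i$ (that is, $k_i$ new vertices each adjacent only to the $i$th path vertex). An independent set in a graph $H$ is a set of pairwise non-adjacent vertices; $i_H(t)$ is the number of independent sets of size $t$ in $H$, $\alpha(H)$ is the size of the largest independent set, and the independent set sequence of $H$ is $(i_H(t))_{t=0}^{\alpha(H)}$. A finite real sequence $(a_0,\dots,a_N)$ is unimodal if there is $m$, $0\le m\le N$, with $a_0\le a_1\le\dots\le a_m\ge a_{m+1}\ge\dots\ge a_N$. *)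

theory Defs
  imports "HOL-Analysis.Analysis" "Graph_Theory.Pair_Digraph"
begin

text \<open>A finite simple graph is a \<open>pair_graph\<close>: a finite loop-free pair digraph whose arc set
  is symmetric, the two arcs \<open>(u, v)\<close> and \<open>(v, u)\<close> together standing for one edge.\<close>

definition independent_set :: "'a pair_pre_digraph \<Rightarrow> 'a set \<Rightarrow> bool" where
  "independent_set G S \<longleftrightarrow>
     finite S \<and> S \<subseteq> pverts G \<and> pairwise (\<lambda>u v. (u, v) \<notin> parcs G) S"

definition num_independent_sets :: "'a pair_pre_digraph \<Rightarrow> nat \<Rightarrow> nat" where
  "num_independent_sets G t = card {S. independent_set G S \<and> card S = t}"

definition independence_number :: "'a pair_pre_digraph \<Rightarrow> nat" where
  "independence_number G = Max {card S | S. independent_set G S}"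

text \<open>Unimodality of the finite sequence \<open>a 0, \<dots>, a N\<close>; values of \<open>a\<close> beyond \<open>N\<close> are
  irrelevant.\<close>

definition unimodal_upto :: "nat \<Rightarrow> (nat \<Rightarrow> real) \<Rightarrow> bool" where
  "unimodal_upto N a \<longleftrightarrow>
     (\<exists>m\<le>N. (\<forall>i<m. a i \<le> a (Suc i)) \<and> (\<forall>i. m \<le> i \<and> i < N \<longrightarrow> a i \<ge> a (Suc i)))"

definition unimodal_independent_set_sequence :: "'a pair_pre_digraph \<Rightarrow> bool" where
  "unimodal_independent_set_sequence G \<longleftrightarrow>
     unimodal_upto (independence_number G) (\<lambda>t. real (num_independent_sets G t))"

datatype caterpillar_vertex = Spine nat | Pendant nat nat

text \<open>The path vertices are numbered from 0, so that the list entry \<open>ks ! i\<close> is the number of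
  pendant edges at \<open>Spine i\<close>, the \<open>(i+1)\<close>st vertex of the path.\<close>

definition caterpillar_edges :: "nat list \<Rightarrow> (caterpillar_vertex \<times> caterpillar_vertex) set" where
  "caterpillar_edges ks =
     {(Spine i, Spine (Suc i)) | i. Suc i < length ks} \<union>
     {(Spine i, Pendant i j) | i j. i < length ks \<and> j < ks ! i}"

definition caterpillar :: "nat list \<Rightarrow> caterpillar_vertex pair_pre_digraph" where
  "caterpillar ks =
     \<lparr> pverts = {Spine i | i. i < length ks} \<union> {Pendant i j | i j. i < length ks \<and> j < ks ! i},
       parcs = caterpillar_edges ks \<union> (caterpillar_edges ks)\<inverse> \<rparr>"

lemma finite_pverts_caterpillar: "finite (pverts (caterpillar ks))"
proof -
  have "{Pendant i j | i j. i < length ks \<and> j < ks ! i} =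
      (\<Union>i<length ks. Pendant i ` {..<ks ! i})" by auto
  then show ?thesis by (simp add: caterpillar_def)
qed

lemma pair_graph_caterpillar: "pair_graph (caterpillar ks)"
proof -
  have sub: "parcs (caterpillar ks) \<subseteq> pverts (caterpillar ks) \<times> pverts (caterpillar ks)"
    by (auto simp: caterpillar_def caterpillar_edges_def)
  then have "finite (parcs (caterpillar ks))"
    by (rule finite_subset) (simp add: finite_pverts_caterpillar)
  moreover have "sym (parcs (caterpillar ks))"
    by (auto simp: caterpillar_def sym_def)
  ultimately show ?thesis
    using sub finite_pverts_caterpillar
    by unfold_locales
      (auto simp: symmetric_def arcs_ends_def arc_to_ends_def
            caterpillar_def caterpillar_edges_def)
qed

end

theory Submission
  imports Defs
begin

text \<open>Split the independent sets by whether they contain the last path vertex \<open>v\<close>. Those avoiding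
  \<open>v\<close> are an independent set of the remaining caterpillar together with any set of the \<open>k\<close> pendant
  vertices at \<open>v\<close>, so they contribute a sum of shifted rows \<open>C(k, t - i)\<close> with bounded shifts \<open>i\<close>.
  For large \<open>k\<close> every shifted row is concave in a window around \<open>k/2\<close> that covers all the shifts,
  which makes the sum unimodal. Those containing \<open>v\<close> contribute a bounded amount, for small \<open>t\<close>
  only, where the sum increases so steeply that nothing is lost.\<close>

lemma unimodal_uptoI:
  assumes "\<And>i. i < m \<Longrightarrow> a i \<le> a (Suc i)" and "\<And>i. m \<le> i \<Longrightarrow> a (Suc i) \<le> a i"
  shows "unimodal_upto N a"
  unfolding unimodal_upto_def
  \<comment> \<open>If \<open>m\<close> exceeds \<open>N\<close>, the truncated sequence only rises
    and turns at \<open>N\<close>. This lets the independence number stay uncomputed.\<close>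
  by (rule exI[of _ "min m N"]) (auto intro: assms)

section \<open>Growth and concavity of a binomial row\<close>

text \<open>The ratio (k - j)/(j + 1) of consecutive entries with denominators cleared; for
  \<open>j \<ge> k\<close> truncated subtraction makes both sides 0. All comparisons below rest on
  it.\<close>

lemma Suc_times_binomial_Suc: "Suc j * (k choose Suc j) = (k - j) * (k choose j)"
  using binomial_absorb_comp[of k j] Suc_times_binomial_eq[of "k - 1" j] by (cases k) auto

lemma binomial_le_Suc:
  assumes "2 * j + 1 \<le> k"
  shows "k choose j \<le> k choose Suc j"
proof -
  have "Suc j * (k choose j) \<le> Suc j * (k choose Suc j)"
    unfolding Suc_times_binomial_Suc using assms by (intro mult_right_mono) auto
  then show ?thesis by (simp only: mult_le_cancel1 zero_less_Suc)
qed

lemma binomial_Suc_le: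
  assumes "k \<le> 2 * j + 1"
  shows "k choose Suc j \<le> k choose j"
proof -
  have "Suc j * (k choose Suc j) \<le> Suc j * (k choose j)"
    unfolding Suc_times_binomial_Suc using assms by (intro mult_right_mono) auto
  then show ?thesis by (simp only: mult_le_cancel1 zero_less_Suc)
qed

text \<open>The ratio of the two entries is at least \<open>1 + R\<close>, and the smaller one is at
  least 1. The gap serves to absorb a perturbation bounded by \<open>R\<close>.\<close>

lemma binomial_gap:
  assumes "2 * j + 1 + R * Suc j \<le> k"
  shows "(k choose j) + R \<le> k choose Suc j"
proof -
  have "1 \<le> k choose j" using assms by (simp add: Suc_le_eq)
  then have "Suc j * R \<le> Suc j * R * (k choose j)" by simp
  then have "Suc j * ((k choose j) + R) \<le> (Suc j + Suc j * R) * (k choose j)"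
    by (simp only: add_mult_distrib add_mult_distrib2 add_le_cancel_left)
  also have "\<dots> \<le> (k - j) * (k choose j)"
    using assms by (intro mult_right_mono) (auto simp: algebra_simps)
  also have "\<dots> = Suc j * (k choose Suc j)" by (simp only: Suc_times_binomial_Suc)
  finally show ?thesis by (simp only: mult_le_cancel1 zero_less_Suc)
qed

text \<open>The sign of the second difference is governed by a quadratic in \<open>j\<close>, so the
  row is concave within sqrt(k + 2)/2 of its centre. The hypothesis says this of the middle index
  \<open>j + 1\<close>.\<close>

lemma binomial_concave:
  assumes "(int k - 2 * int j - 2)\<^sup>2 \<le> int k + 2"
  shows "(k choose j) + (k choose Suc (Suc j)) \<le> 2 * (k choose Suc j)"
proof -
  \<comment> \<open>Outside the row the hypothesis would force (j + 2)^2 \<le> j + 2.\<close>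
  have "j < k"
  proof (rule ccontr)
    assume "\<not> j < k"
    then have "int j + 2 \<le> 2 * int j + 2 - int k" by linarith
    then have "(int j + 2)\<^sup>2 \<le> (2 * int j + 2 - int k)\<^sup>2"
      by (intro power_mono) auto
    also have "\<dots> = (int k - 2 * int j - 2)\<^sup>2"
      by (simp add: power2_eq_square algebra_simps)
    also note assms
    also have "int k + 2 \<le> 1 * (int j + 2)" using \<open>\<not> j < k\<close> by simp
    finally have "(int j + 2) * (int j + 2) \<le> 1 * (int j + 2)"
      by (simp only: power2_eq_square)
    then show False by (simp only: mult_le_cancel_right) simp
  qed
  define x y a b c where "x = int k - int j" and "y = int j + 2"
    and "a = int (k choose j)" and "b = int (k choose Suc j)"
    and "c = int (k choose Suc (Suc j))"
  have xy: "x > 0" "y > 0" using \<open>j < k\<close> by (auto simp: x_def y_def)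
  have ab: "(y - 1) * b = x * a"
    using arg_cong[OF Suc_times_binomial_Suc[of j k], of int] \<open>j < k\<close>
    by (simp add: x_def y_def a_def b_def of_nat_diff algebra_simps)
  have "int (k - Suc j) = x - 1" using \<open>j < k\<close> by (simp add: x_def of_nat_diff)
  then have bc: "y * c = (x - 1) * b"
    using arg_cong[OF Suc_times_binomial_Suc[of "Suc j" k], of int]
    unfolding of_nat_mult by (simp add: y_def b_def c_def add.commute)
  \<comment> \<open>The factor \<open>x * y\<close> turns both outer entries into multiples of
    \<open>b\<close>; then x + y = k + 2 and x - y = k - 2j - 2 match the hypothesis.\<close>
  have "x * y * (2 * b - a - c) = 2 * x * y * b - y * (x * a) - x * (y * c)"
    by (simp add: algebra_simps)
  also have "\<dots> = b * (x + y - (x - y)\<^sup>2)"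
    unfolding ab[symmetric] bc by (simp add: algebra_simps power2_eq_square)
  also have "\<dots> \<ge> 0"
    using assms by (intro mult_nonneg_nonneg) (auto simp: x_def y_def b_def algebra_simps)
  finally have "2 * b - a - c \<ge> 0"
    using mult_pos_pos[OF xy] by (simp only: zero_le_mult_iff) linarith
  then show ?thesis by (simp add: a_def b_def c_def)
qed

section \<open>Sums of shifted binomial rows\<close>

text \<open>The coefficient of x^t in x^i (1 + x)^k. The case \<open>t < i\<close> is set to 0
  explicitly, since truncated subtraction would give 1.\<close>

definition shifted_binomial :: "nat \<Rightarrow> nat \<Rightarrow> nat \<Rightarrow> nat" where
  "shifted_binomial k i t = (if i \<le> t then k choose (t - i) else 0)"

lemma shifted_binomial_le_Suc:
  assumes "2 * t + 1 \<le> k"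
  shows "shifted_binomial k i t \<le> shifted_binomial k i (Suc t)"
  using assms binomial_le_Suc[of "t - i" k] by (auto simp: shifted_binomial_def Suc_diff_le)

lemma shifted_binomial_Suc_le:
  assumes "k + 2 * i \<le> 2 * t + 1" and "i \<le> t"
  shows "shifted_binomial k i (Suc t) \<le> shifted_binomial k i t"
  using assms binomial_Suc_le[of k "t - i"] by (auto simp: shifted_binomial_def Suc_diff_le)

lemma shifted_binomial_concave:
  assumes "(int k + 2 * int i - 2 * int t - 2)\<^sup>2 \<le> int k + 2" and "i \<le> t"
  shows "shifted_binomial k i t + shifted_binomial k i (Suc (Suc t)) \<le>
    2 * shifted_binomial k i (Suc t)"
  using assms binomial_concave[of k "t - i"]
  by (auto simp: shifted_binomial_def Suc_diff_le of_nat_diff algebra_simps)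

text \<open>\<open>k1\<close> makes the unshifted row of \<open>z\<close> outgrow the perturbation
  \<open>r\<close> and confines \<open>r\<close> to the first half, \<open>k2\<close> puts the
  middle beyond all shifts, and \<open>k3\<close> makes every row concave between \<open>k/2\<close>
  and \<open>k/2 + d\<close>.\<close>

lemma unimodal_sum_shifted_binomial:
  fixes s :: "'a \<Rightarrow> nat" and r :: "nat \<Rightarrow> nat"
  assumes "finite F" and s: "\<And>A. A \<in> F \<Longrightarrow> s A \<le> d" and "z \<in> F" "s z = 0"
    and r: "\<And>t. r t \<le> R" and r0: "\<And>t. t > D \<Longrightarrow> r t = 0"
    and k1: "2 * D + 1 + R * Suc D \<le> k" and k2: "2 * d + 1 \<le> k" and k3: "(2 * d)\<^sup>2 \<le> k"
  shows "unimodal_upto N (\<lambda>t. real ((\<Sum>A\<in>F. shifted_binomial k (s A) t) + r t))"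
proof -
  define f where "f t = (\<Sum>A\<in>F. shifted_binomial k (s A) t)" for t
  have inc: "f t + r t \<le> f (Suc t) + r (Suc t)" if t: "2 * t + 1 \<le> k" for t
  proof (cases "t \<le> D")
    case True
    have "2 * t + 1 + R * Suc t \<le> 2 * D + 1 + R * Suc D"
      using True by (intro add_mono mult_mono) auto
    \<comment> \<open>The row of \<open>z\<close> alone gains \<open>R\<close>, which covers any
      drop of \<open>r\<close>; the other rows need only not decrease.\<close>
    then have "(k choose t) + R \<le> k choose Suc t"
      using k1 by (intro binomial_gap) linarith
    then have "shifted_binomial k (s z) t + R \<le> shifted_binomial k (s z) (Suc t)"
      using \<open>s z = 0\<close> by (simp add: shifted_binomial_def)
    moreover have "(\<Sum>A\<in>F - {z}. shifted_binomial k (s A) t) \<le>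
        (\<Sum>A\<in>F - {z}. shifted_binomial k (s A) (Suc t))"
      by (intro sum_mono shifted_binomial_le_Suc t)
    ultimately have "f t + R \<le> f (Suc t)"
      unfolding f_def by (simp add: sum.remove[OF \<open>finite F\<close> \<open>z \<in> F\<close>])
    then show ?thesis using r[of t] by linarith
  next
    case False
    have "f t \<le> f (Suc t)"
      unfolding f_def by (intro sum_mono shifted_binomial_le_Suc t)
    then show ?thesis using False by (simp add: r0)
  qed
  have dec: "f (Suc t) \<le> f t" if "k + 2 * d \<le> 2 * t + 1" for t
    unfolding f_def using that k2 s
    by (intro sum_mono shifted_binomial_Suc_le) (fastforce dest!: s)+
  \<comment> \<open>The middle index \<open>t + 1\<close> is at most \<open>d\<close> away from the
    centre \<open>k/2 + s A\<close> of each row, whence the bound (2d)^2 in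
    \<open>k3\<close>.\<close>
  have conc: "f t + f (Suc (Suc t)) \<le> 2 * f (Suc t)"
    if t: "k \<le> 2 * t + 1" "2 * t + 2 \<le> k + 2 * d" for t
  proof -
    have "shifted_binomial k (s A) t + shifted_binomial k (s A) (Suc (Suc t)) \<le>
        2 * shifted_binomial k (s A) (Suc t)" if "A \<in> F" for A
    proof (rule shifted_binomial_concave)
      have "\<bar>int k + 2 * int (s A) - 2 * int t - 2\<bar> \<le> \<bar>2 * int d\<bar>"
        using t s[OF that] by linarith
      then have "(int k + 2 * int (s A) - 2 * int t - 2)\<^sup>2 \<le> (2 * int d)\<^sup>2"
        by (simp only: abs_le_square_iff)
      also have "\<dots> \<le> int k" 
        using k3 by (metis of_nat_le_iff of_nat_mult of_nat_numeral of_nat_power)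
      finally show "(int k + 2 * int (s A) - 2 * int t - 2)\<^sup>2 \<le> int k + 2" by simp
      show "s A \<le> t" using s[OF that] t k2 by linarith
    qed
    then have "(\<Sum>A\<in>F. shifted_binomial k (s A) t + shifted_binomial k (s A) (Suc (Suc t))) \<le>
        (\<Sum>A\<in>F. 2 * shifted_binomial k (s A) (Suc t))"
      by (rule sum_mono)
    then show ?thesis by (simp add: f_def sum.distrib sum_distrib_left)
  qed
  \<comment> \<open>Only descents from the middle on count: there concavity is available and
    \<open>r (Suc t)\<close> vanishes. The turning point is the first of them.\<close>
  define P where "P t \<longleftrightarrow> k \<le> 2 * t + 1 \<and> f (Suc t) \<le> f t" for t
  define m where "m = (LEAST t. P t)"
  have "P (k + d)" unfolding P_def using dec[of "k + d"] by simp
  then have "P m" unfolding m_def by (rule LeastI)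
  have tail: "P t" if "m \<le> t" for t
    using that
  proof (induction rule: dec_induct)
    case base
    show ?case by (rule \<open>P m\<close>)
  next
    case (step t)
    \<comment> \<open>Within the window concavity passes the descent on to the next index; past it
      every row falls.\<close>
    then show ?case
      using dec[of "Suc t"] conc[of t] unfolding P_def
      by (cases "2 * t + 2 \<le> k + 2 * d") auto
  qed
  have mono: "f i + r i \<le> f (Suc i) + r (Suc i)" if "i < m" for i
  proof (cases "2 * i + 1 \<le> k")
    case True
    then show ?thesis by (rule inc)
  next
    case False
    \<comment> \<open>Past the middle, \<open>P i\<close> can fail only through its second
      conjunct.\<close>
    then have "f i < f (Suc i)"
      using not_less_Least[of i P] that unfolding m_def P_def by auto
    moreover have "r i = 0" using False k1 by (intro r0) auto
    ultimately show ?thesis by linarith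
  qed
  have anti: "f (Suc i) + r (Suc i) \<le> f i + r i" if "m \<le> i" for i
  proof -
    have "r (Suc i) = 0" using tail[OF that] k1 by (intro r0) (auto simp: P_def)
    then show ?thesis using tail[OF that] by (simp add: P_def)
  qed
  show ?thesis
    unfolding f_def[symmetric]
    by (rule unimodal_uptoI[of m]) (use mono anti in \<open>simp_all only: of_nat_le_iff\<close>)
qed

section \<open>Independent sets and the last path vertex\<close>

lemma pverts_caterpillar_snoc:
  "pverts (caterpillar (ks @ [k])) =
     insert (Spine (length ks)) (pverts (caterpillar ks) \<union> Pendant (length ks) ` {..<k})"
  by (auto simp: caterpillar_def nth_append less_Suc_eq)

lemma Spine_notin_caterpillar: "Spine (length ks) \<notin> pverts (caterpillar ks)"
  by (auto simp: caterpillar_def)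

lemma Pendant_notin_caterpillar: "Pendant (length ks) j \<notin> pverts (caterpillar ks)"
  by (auto simp: caterpillar_def)

lemma parcs_caterpillar_snoc:
  assumes "u \<noteq> Spine (length ks)" and "v \<noteq> Spine (length ks)"
  shows "(u, v) \<in> parcs (caterpillar (ks @ [k])) \<longleftrightarrow> (u, v) \<in> parcs (caterpillar ks)"
  using assms
  by (auto simp: caterpillar_def caterpillar_edges_def nth_append less_Suc_eq)

lemma parcs_caterpillar_pverts:
  "(u, v) \<in> parcs (caterpillar ks) \<Longrightarrow> u \<in> pverts (caterpillar ks) \<and> v \<in> pverts (caterpillar ks)"
  by (auto simp: caterpillar_def caterpillar_edges_def)

text \<open>The only neighbour of a pendant vertex in \<open>B\<close> is the last path vertex,
  which lies in neither set, so \<open>B\<close> creates no adjacency.\<close>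

lemma independent_set_snoc_iff:
  assumes "A \<subseteq> pverts (caterpillar ks)" and "B \<subseteq> Pendant (length ks) ` {..<k}"
  shows "independent_set (caterpillar (ks @ [k])) (A \<union> B) \<longleftrightarrow> independent_set (caterpillar ks) A"
proof -
  let ?G = "caterpillar (ks @ [k])" and ?H = "caterpillar ks"
  have ne: "u \<noteq> Spine (length ks)" if "u \<in> A \<union> B" for u
    using that assms Spine_notin_caterpillar[of ks] by auto
  have "pairwise (\<lambda>u v. (u, v) \<notin> parcs ?G) (A \<union> B) \<longleftrightarrow>
      pairwise (\<lambda>u v. (u, v) \<notin> parcs ?H) (A \<union> B)"
    using ne by (auto simp: pairwise_def parcs_caterpillar_snoc)
  also have "\<dots> \<longleftrightarrow> pairwise (\<lambda>u v. (u, v) \<notin> parcs ?H) A"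
    using assms(2) parcs_caterpillar_pverts[of _ _ ks] Pendant_notin_caterpillar[of ks]
    unfolding pairwise_def by blast
  finally show ?thesis
    using assms finite_subset[OF assms(1) finite_pverts_caterpillar] finite_subset[OF assms(2)]
    by (auto simp: independent_set_def pverts_caterpillar_snoc)
qed

lemma finite_independent_sets: "finite {S. independent_set (caterpillar ks) S}"
  by (rule finite_subset[of _ "Pow (pverts (caterpillar ks))"])
    (auto simp: independent_set_def finite_pverts_caterpillar)

lemma card_subsets_shifted:
  assumes "finite P"
  shows "card {B. B \<subseteq> P \<and> i + card B = t} = shifted_binomial (card P) i t"
proof (cases "i \<le> t")
  case True
  then have "{B. B \<subseteq> P \<and> i + card B = t} = {B. B \<subseteq> P \<and> card B = t - i}" by auto
  then show ?thesis using True n_subsets[OF assms] by (simp add: shifted_binomial_def)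
qed (auto simp: shifted_binomial_def)

text \<open>Such a set splits uniquely into an independent set \<open>A\<close> of the shorter
  caterpillar and an arbitrary set of last pendants. The generating function is thus the
  independence polynomial of the shorter caterpillar times (1 + x)^k.\<close>

lemma card_independent_sets_avoiding:
  "card {S. independent_set (caterpillar (ks @ [k])) S \<and> card S = t \<and> Spine (length ks) \<notin> S} =
     (\<Sum>A | independent_set (caterpillar ks) A. shifted_binomial k (card A) t)"
    (is "card ?X = _")
proof -
  let ?V = "pverts (caterpillar ks)" and ?P = "Pendant (length ks) ` {..<k}"
  let ?F = "{A. independent_set (caterpillar ks) A}"
  let ?T = "SIGMA A : ?F. {B. B \<subseteq> ?P \<and> card A + card B = t}"
  have disj: "?V \<inter> ?P = {}" using Pendant_notin_caterpillar[of ks] by auto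
  have sub: "A \<subseteq> ?V" if "A \<in> ?F" for A using that by (simp add: independent_set_def)
  have card_Un: "card (A \<union> B) = card A + card B" if "A \<subseteq> ?V" "B \<subseteq> ?P" for A B
    using that disj finite_subset[OF that(1) finite_pverts_caterpillar] finite_subset[OF that(2)]
    by (intro card_Un_disjoint) auto
  have "bij_betw (\<lambda>(A, B). A \<union> B) ?T ?X"
  proof (rule bij_betw_byWitness[where f' = "\<lambda>S. (S \<inter> ?V, S \<inter> ?P)"])
    show "\<forall>p\<in>?T. (\<lambda>S. (S \<inter> ?V, S \<inter> ?P)) ((\<lambda>(A, B). A \<union> B) p) = p"
      using sub disj by fastforce
    have split: "S = (S \<inter> ?V) \<union> (S \<inter> ?P)" if "S \<in> ?X" for S
      using that by (auto simp: independent_set_def pverts_caterpillar_snoc)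
    then show "\<forall>S\<in>?X. (\<lambda>(A, B). A \<union> B) (S \<inter> ?V, S \<inter> ?P) = S" by blast
    show "(\<lambda>(A, B). A \<union> B) ` ?T \<subseteq> ?X"
      using sub Spine_notin_caterpillar[of ks]
      by (fastforce simp: independent_set_snoc_iff card_Un)
    show "(\<lambda>S. (S \<inter> ?V, S \<inter> ?P)) ` ?X \<subseteq> ?T"
    proof (rule image_subsetI)
      fix S assume S: "S \<in> ?X"
      have "independent_set (caterpillar ks) (S \<inter> ?V)"
        using independent_set_snoc_iff[of "S \<inter> ?V" ks "S \<inter> ?P" k] split[OF S] S by simp
      moreover have "card (S \<inter> ?V) + card (S \<inter> ?P) = t"
        using card_Un[of "S \<inter> ?V" "S \<inter> ?P"] split[OF S] S by simp
      ultimately show "(S \<inter> ?V, S \<inter> ?P) \<in> ?T" by simp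
    qed
  qed
  then have "card ?X = card ?T" by (simp add: bij_betw_same_card)
  also have "\<dots> = (\<Sum>A\<in>?F. card {B. B \<subseteq> ?P \<and> card A + card B = t})"
    by (rule card_SigmaI) (auto simp: finite_independent_sets)
  also have "\<dots> = (\<Sum>A\<in>?F. shifted_binomial k (card A) t)"
    by (simp add: card_subsets_shifted card_image inj_on_def)
  finally show ?thesis .
qed

text \<open>The last path vertex excludes all its pendants. This bounds the number and size of these
  sets independently of \<open>k\<close>.\<close>

lemma independent_set_containing:
  assumes "independent_set (caterpillar (ks @ [k])) S" and "Spine (length ks) \<in> S"
  shows "S - {Spine (length ks)} \<subseteq> pverts (caterpillar ks)"
proof -
  have "Pendant (length ks) j \<notin> S" if "j < k" for j
  proof
    assume "Pendant (length ks) j \<in> S"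
    then have "(Spine (length ks), Pendant (length ks) j) \<notin> parcs (caterpillar (ks @ [k]))"
      using assms by (auto simp: independent_set_def pairwise_def)
    then show False using that by (simp add: caterpillar_def caterpillar_edges_def)
  qed
  then show ?thesis
    using assms by (auto simp: independent_set_def pverts_caterpillar_snoc)
qed

theorem corollary1p12:
  fixes n :: nat and ks :: "nat list"
  assumes "n \<ge> 1" and "length ks = n - 1"
  shows "\<exists>K. \<forall>k\<ge>K. unimodal_independent_set_sequence (caterpillar (ks @ [k]))"
proof -
  let ?V = "pverts (caterpillar ks)" and ?v = "Spine (length ks)"
  let ?F = "{A. independent_set (caterpillar ks) A}"
  define d where "d = card ?V"
  \<comment> \<open>A set containing the last path vertex has at most \<open>d + 1\<close> elements
    and is determined by a subset of \<open>?V\<close>, which gives \<open>D = Suc d\<close> and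
    \<open>R = 2 ^ d\<close>; the last summand secures concavity.\<close>
  define K where "K = 2 * Suc d + 1 + 2 ^ d * Suc (Suc d) + (2 * d)\<^sup>2"
  have "unimodal_independent_set_sequence (caterpillar (ks @ [k]))" if k: "k \<ge> K" for k
  proof -
    let ?G = "caterpillar (ks @ [k])"
    define Y where "Y t = {S. independent_set ?G S \<and> card S = t \<and> ?v \<in> S}" for t
    have fin: "finite {S. independent_set ?G S \<and> Q S}" for Q
      using finite_independent_sets[of "ks @ [k]"] by (rule rev_finite_subset) auto
    have count: "num_independent_sets ?G t =
        (\<Sum>A\<in>?F. shifted_binomial k (card A) t) + card (Y t)" for t
    proof -
      let ?X = "{S. independent_set ?G S \<and> card S = t \<and> ?v \<notin> S}"
      have "num_independent_sets ?G t = card (?X \<union> Y t)"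
        unfolding num_independent_sets_def Y_def by (rule arg_cong[of _ _ card]) auto
      also have "\<dots> = card ?X + card (Y t)"
        unfolding Y_def by (rule card_Un_disjoint) (auto intro: fin)
      finally show ?thesis by (simp only: card_independent_sets_avoiding)
    qed
    have Y_sub: "S - {?v} \<subseteq> ?V" if "S \<in> Y t" for S t
      using that independent_set_containing by (auto simp: Y_def)
    have Y_card: "card (Y t) \<le> 2 ^ d" for t
    proof -
      have "card (Y t) \<le> card (Pow ?V)"
      proof (rule card_inj_on_le)
        show "inj_on (\<lambda>S. S - {?v}) (Y t)" by (auto simp: Y_def inj_on_def)
        show "(\<lambda>S. S - {?v}) ` Y t \<subseteq> Pow ?V" using Y_sub by blast
      qed (simp add: finite_pverts_caterpillar)
      then show ?thesis by (simp add: card_Pow finite_pverts_caterpillar d_def)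
    qed
    have Y_empty: "card (Y t) = 0" if "t > Suc d" for t
    proof -
      have "card S \<le> Suc d" if "S \<in> Y t" for S
        using card_mono[OF finite_pverts_caterpillar Y_sub[OF that]] that
        by (simp add: Y_def d_def)
      then have "Y t = {}" using that by (force simp: Y_def)
      then show ?thesis by simp
    qed
    have "unimodal_upto (independence_number ?G)
        (\<lambda>t. real ((\<Sum>A\<in>?F. shifted_binomial k (card A) t) + card (Y t)))"
    \<comment> \<open>The shifts are the sizes of independent sets of the shorter caterpillar; the
      empty set supplies the unshifted row.\<close>
    proof (rule unimodal_sum_shifted_binomial[where z = "{}" and d = d and D = "Suc d"
          and R = "2 ^ d"])
      show "card A \<le> d" if "A \<in> ?F" for A
        using that card_mono[OF finite_pverts_caterpillar] by (simp add: independent_set_def d_def)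
      show "{} \<in> ?F" by (simp add: independent_set_def)
      show "card (Y t) \<le> 2 ^ d" for t by (rule Y_card)
      show "card (Y t) = 0" if "t > Suc d" for t using that by (rule Y_empty)
    qed (use k in \<open>auto simp: K_def finite_independent_sets\<close>)
    then show ?thesis by (simp only: unimodal_independent_set_sequence_def count)
  qed
  then show ?thesis by blast
qed

end
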